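(* Let $X$ be a non-empty set, let $\mathcal{B}$ be a collection of picture fuzzy subsets of $X$ with $I, O \notin \mathcal{B}$, and let $\mathfrak{I}$ be a collection of picture fuzzy subsets of $X$ such that (i) $I, O \in \mathfrak{I}$; (ii) for every picture fuzzy subset $V$ of $X$: $V \in \mathfrak{I}\setminus\{O,I\}$ and $V \nparallel O$ if and only if there is a non-empty family $\{\beta_i\}_{i\in\Omega}$ of members of $\mathcal{B}$ with $V = \bigcup_{i\in\Omega}\beta_i$; (iii) for every picture fuzzy subset $V$ of $X$: $V \in \mathfrak{I}\setminus\{O,I\}$ and $V \parallel O$ if and only if there is a non-empty family $\{\beta_i\}_{i\in\Omega}$ of members of $\mathcal{B}$ with $V = O \cup \bigl(\bigcup_{i\in\Omega}\beta_i\bigr)$. If $\mathcal{B}$ is closed under finite intersections, then $\mathcal{B}$ is a picture fuzzy base for $\mathfrak{I}$, i.e. $\mathfrak{I}$ is a picture fuzzy topology on $X$.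
   Context: A picture fuzzy subset $\aleph$ of a non-empty set $X$ is a triple of functions $\mu_\aleph,\rho_\aleph,\sigma_\aleph: X\to[0,1]$ (positive, neutral and negative membership) with $\mu_\aleph(x)+\rho_\aleph(x)+\sigma_\aleph(x)\le 1$ for all $x\in X$. Two picture fuzzy subsets are equal iff their three membership functions coincide. Union $\aleph_1\cup\aleph_2$: $\mu=\max(\mu_{\aleph_1},\mu_{\aleph_2})$, $\rho=\min(\rho_{\aleph_1},\rho_{\aleph_2})$, $\sigma=\min(\sigma_{\aleph_1},\sigma_{\aleph_2})$ pointwise. Intersection $\aleph_1\cap\aleph_2$: $\mu=\min(\mu_{\aleph_1},\mu_{\aleph_2})$, $\rho=\min(\rho_{\aleph_1},\rho_{\aleph_2})$, $\sigma=\max(\sigma_{\aleph_1},\sigma_{\aleph_2})$ pointwise. For infinite families, max and min are replaced by sup and inf. $I$ is the picture fuzzy subset with $(\mu,\rho,\sigma)=(1,0,0)$ at every $x$; $O$ is the one with $(\mu,\rho,\sigma)=(0,0,1)$ at every $x$. $\aleph_1\parallel\aleph_2$ ($\rho$-equivalent) means $\rho_{\aleph_1}(x)=\rho_{\aleph_2}(x)$ for all $x\in X$; $\nparallel$ is its negation. A family $\mathfrak{I}$ of picture fuzzy subsets of $X$ is a picture fuzzy topology on $X$ if $I,O\in\mathfrak{I}$; $\aleph_1\cap\aleph_2\in\mathfrak{I}$ for all $\aleph_1,\aleph_2\in\mathfrak{I}$; and $\bigcup_{i\in\Omega}\aleph_i\in\mathfrak{I}$ for every non-empty family $\{\aleph_i\}_{i\in\Omega}\subseteq\mathfrak{I}$.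 For $\mathcal{B}$ and $\mathfrak{I}$ related by (i)–(iii), $\mathcal{B}$ is called a picture fuzzy base for $\mathfrak{I}$ if $\mathfrak{I}$ is a picture fuzzy topology on $X$. "Closed under finite intersections" refers to intersections of finitely many (at least one) members. *)

theory Defs
  imports Complex_Main
begin

text \<open>The underlying non-empty set \<open>X\<close> is the universe of the type \<open>'x\<close>.\<close>

typedef 'x pfs =
  "{(\<mu> :: 'x \<Rightarrow> real, \<rho> :: 'x \<Rightarrow> real, \<sigma> :: 'x \<Rightarrow> real).
     \<forall>x. \<mu> x \<in> {0..1} \<and> \<rho> x \<in> {0..1} \<and> \<sigma> x \<in> {0..1} \<and> \<mu> x + \<rho> x + \<sigma> x \<le> 1}"
  by (rule exI [of _ "(\<lambda>_. 1, \<lambda>_. 0, \<lambda>_. 0)"]) simp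

setup_lifting type_definition_pfs

lift_definition pos :: "'x pfs \<Rightarrow> 'x \<Rightarrow> real" is "\<lambda>(\<mu>, \<rho>, \<sigma>). \<mu>" .
lift_definition neu :: "'x pfs \<Rightarrow> 'x \<Rightarrow> real" is "\<lambda>(\<mu>, \<rho>, \<sigma>). \<rho>" .
lift_definition neg :: "'x pfs \<Rightarrow> 'x \<Rightarrow> real" is "\<lambda>(\<mu>, \<rho>, \<sigma>). \<sigma>" .

lemma pfs_eqI:
  assumes "\<And>x. pos A x = pos B x" "\<And>x. neu A x = neu B x" "\<And>x. neg A x = neg B x"
  shows "A = B"
  using assms by transfer (auto simp: fun_eq_iff)

lemma pfs_bounds:
  "0 \<le> pos A x" "pos A x \<le> 1" "0 \<le> neu A x" "neu A x \<le> 1" "0 \<le> neg A x" "neg A x \<le> 1"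
  "pos A x + neu A x + neg A x \<le> 1"
  by (transfer; auto)+

lift_definition pf_I :: "'x pfs" is "(\<lambda>_. 1, \<lambda>_. 0, \<lambda>_. 0)" by simp
lift_definition pf_O :: "'x pfs" is "(\<lambda>_. 0, \<lambda>_. 0, \<lambda>_. 1)" by simp

lift_definition pf_union :: "'x pfs \<Rightarrow> 'x pfs \<Rightarrow> 'x pfs"  (infixl \<open>\<union>\<^sub>p\<close> 65)
  is "\<lambda>(\<mu>1, \<rho>1, \<sigma>1) (\<mu>2, \<rho>2, \<sigma>2).
        (\<lambda>x. max (\<mu>1 x) (\<mu>2 x), \<lambda>x. min (\<rho>1 x) (\<rho>2 x), \<lambda>x. min (\<sigma>1 x) (\<sigma>2 x))"
  apply clarsimp
  subgoal premises prems for _ _ _ _ _ _ x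
    using prems(1)[rule_format, of x] prems(2)[rule_format, of x] by linarith
  done

lift_definition pf_inter :: "'x pfs \<Rightarrow> 'x pfs \<Rightarrow> 'x pfs"  (infixl \<open>\<inter>\<^sub>p\<close> 70)
  is "\<lambda>(\<mu>1, \<rho>1, \<sigma>1) (\<mu>2, \<rho>2, \<sigma>2).
        (\<lambda>x. min (\<mu>1 x) (\<mu>2 x), \<lambda>x. min (\<rho>1 x) (\<rho>2 x), \<lambda>x. max (\<sigma>1 x) (\<sigma>2 x))"
  apply clarsimp
  subgoal premises prems for _ _ _ _ _ _ x
    using prems(1)[rule_format, of x] prems(2)[rule_format, of x] by linarith
  done

lemma SUP_INF_INF_bounds:
  fixes f g h :: "'i \<Rightarrow> real"
  assumes ne: "F \<noteq> {}"
    and b: "\<And>i. i \<in> F \<Longrightarrow> f i \<in> {0..1} \<and> g i \<in> {0..1} \<and> h i \<in> {0..1} \<and> f i + g i + h i \<le> 1"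
  shows "(SUP i\<in>F. f i) \<in> {0..1} \<and> (INF i\<in>F. g i) \<in> {0..1} \<and> (INF i\<in>F. h i) \<in> {0..1} \<and>
         (SUP i\<in>F. f i) + (INF i\<in>F. g i) + (INF i\<in>F. h i) \<le> 1"
proof -
  obtain j where j: "j \<in> F" using ne by blast
  have bf: "bdd_above (f ` F)" using b by (intro bdd_aboveI2 [of _ _ 1]) auto
  have bg: "bdd_below (g ` F)" using b by (intro bdd_belowI2 [of _ 0]) auto
  have bh: "bdd_below (h ` F)" using b by (intro bdd_belowI2 [of _ 0]) auto
  have g0: "0 \<le> (INF i\<in>F. g i)" and h0: "0 \<le> (INF i\<in>F. h i)"
    using b by (auto intro!: cINF_greatest ne)
  have f0: "0 \<le> (SUP i\<in>F. f i)"
    using b [OF j] cSUP_upper [OF j bf] by auto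
  have "f i \<le> 1 - (INF i\<in>F. g i) - (INF i\<in>F. h i)" if "i \<in> F" for i
    using b [OF that] cINF_lower [OF bg that] cINF_lower [OF bh that] by linarith
  then have "(SUP i\<in>F. f i) \<le> 1 - (INF i\<in>F. g i) - (INF i\<in>F. h i)"
    by (intro cSUP_least ne)
  then show ?thesis using f0 g0 h0 by auto
qed

text \<open>Unions and intersections of families are only meaningful for non-empty families: the
  pointwise formulas do not yield a picture fuzzy subset for the empty one. The value at the
  empty family is a dummy.\<close>

definition pf_Union :: "'x pfs set \<Rightarrow> 'x pfs"  (\<open>\<Union>\<^sub>p\<close>) where
  "\<Union>\<^sub>p F = (if F = {} then pf_O else
     Abs_pfs (\<lambda>x. SUP A\<in>F. pos A x, \<lambda>x. INF A\<in>F. neu A x, \<lambda>x. INF A\<in>F. neg A x))"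

definition pf_Inter :: "'x pfs set \<Rightarrow> 'x pfs"  (\<open>\<Inter>\<^sub>p\<close>) where
  "\<Inter>\<^sub>p F = (if F = {} then pf_I else
     Abs_pfs (\<lambda>x. INF A\<in>F. pos A x, \<lambda>x. INF A\<in>F. neu A x, \<lambda>x. SUP A\<in>F. neg A x))"

lemma pfs_I_sel [simp]: "pos pf_I x = 1" "neu pf_I x = 0" "neg pf_I x = 0"
  by (transfer; simp)+

lemma pfs_O_sel [simp]: "pos pf_O x = 0" "neu pf_O x = 0" "neg pf_O x = 1"
  by (transfer; simp)+

lemma pfs_union_sel [simp]:
  "pos (A \<union>\<^sub>p B) x = max (pos A x) (pos B x)"
  "neu (A \<union>\<^sub>p B) x = min (neu A x) (neu B x)"
  "neg (A \<union>\<^sub>p B) x = min (neg A x) (neg B x)"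
  by (transfer; auto)+

lemma pfs_inter_sel [simp]:
  "pos (A \<inter>\<^sub>p B) x = min (pos A x) (pos B x)"
  "neu (A \<inter>\<^sub>p B) x = min (neu A x) (neu B x)"
  "neg (A \<inter>\<^sub>p B) x = max (neg A x) (neg B x)"
  by (transfer; auto)+

lemma pfs_Union_sel:
  assumes "F \<noteq> {}"
  shows "pos (\<Union>\<^sub>p F) x = (SUP A\<in>F. pos A x)"
    and "neu (\<Union>\<^sub>p F) x = (INF A\<in>F. neu A x)"
    and "neg (\<Union>\<^sub>p F) x = (INF A\<in>F. neg A x)"
proof -
  have "\<forall>x. (SUP A\<in>F. pos A x) \<in> {0..1} \<and> (INF A\<in>F. neu A x) \<in> {0..1} \<and>
      (INF A\<in>F. neg A x) \<in> {0..1} \<and>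
      (SUP A\<in>F. pos A x) + (INF A\<in>F. neu A x) + (INF A\<in>F. neg A x) \<le> 1"
    using pfs_bounds by (intro allI SUP_INF_INF_bounds [OF assms]) auto
  then have *: "Rep_pfs (\<Union>\<^sub>p F) =
      (\<lambda>x. SUP A\<in>F. pos A x, \<lambda>x. INF A\<in>F. neu A x, \<lambda>x. INF A\<in>F. neg A x)"
    using assms by (simp add: pf_Union_def Abs_pfs_inverse)
  show "pos (\<Union>\<^sub>p F) x = (SUP A\<in>F. pos A x)"
    "neu (\<Union>\<^sub>p F) x = (INF A\<in>F. neu A x)"
    "neg (\<Union>\<^sub>p F) x = (INF A\<in>F. neg A x)"
    by (simp_all add: pos.rep_eq neu.rep_eq neg.rep_eq *)
qed

lemma pfs_Inter_sel:
  assumes "F \<noteq> {}"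
  shows "pos (\<Inter>\<^sub>p F) x = (INF A\<in>F. pos A x)"
    and "neu (\<Inter>\<^sub>p F) x = (INF A\<in>F. neu A x)"
    and "neg (\<Inter>\<^sub>p F) x = (SUP A\<in>F. neg A x)"
proof -
  have "\<forall>x. (SUP A\<in>F. neg A x) \<in> {0..1} \<and> (INF A\<in>F. pos A x) \<in> {0..1} \<and>
      (INF A\<in>F. neu A x) \<in> {0..1} \<and>
      (SUP A\<in>F. neg A x) + (INF A\<in>F. pos A x) + (INF A\<in>F. neu A x) \<le> 1"
    using pfs_bounds by (intro allI SUP_INF_INF_bounds [OF assms]) (auto simp: algebra_simps)
  then have *: "Rep_pfs (\<Inter>\<^sub>p F) =
      (\<lambda>x. INF A\<in>F. pos A x, \<lambda>x. INF A\<in>F. neu A x, \<lambda>x. SUP A\<in>F. neg A x)"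
    using assms by (simp add: pf_Inter_def Abs_pfs_inverse algebra_simps)
  show "pos (\<Inter>\<^sub>p F) x = (INF A\<in>F. pos A x)"
    "neu (\<Inter>\<^sub>p F) x = (INF A\<in>F. neu A x)"
    "neg (\<Inter>\<^sub>p F) x = (SUP A\<in>F. neg A x)"
    by (simp_all add: pos.rep_eq neu.rep_eq neg.rep_eq *)
qed

lemma pf_Union_pair: "\<Union>\<^sub>p {A, B} = A \<union>\<^sub>p B"
  by (rule pfs_eqI) (simp_all add: pfs_Union_sel cSup_eq_Max cInf_eq_Min)

lemma pf_Inter_pair: "\<Inter>\<^sub>p {A, B} = A \<inter>\<^sub>p B"
  by (rule pfs_eqI) (simp_all add: pfs_Inter_sel cSup_eq_Max cInf_eq_Min)

definition rho_equiv :: "'x pfs \<Rightarrow> 'x pfs \<Rightarrow> bool"  (infix \<open>\<parallel>\<close> 50) where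
  "A \<parallel> B \<longleftrightarrow> (\<forall>x. neu A x = neu B x)"

text \<open>Here and below a family is given by the set of its members, which determines its union
  and intersection.\<close>

definition pf_topology :: "'x pfs set \<Rightarrow> bool" where
  "pf_topology T \<longleftrightarrow>
     pf_I \<in> T \<and> pf_O \<in> T \<and>
     (\<forall>A\<in>T. \<forall>B\<in>T. A \<inter>\<^sub>p B \<in> T) \<and>
     (\<forall>F. F \<noteq> {} \<longrightarrow> F \<subseteq> T \<longrightarrow> \<Union>\<^sub>p F \<in> T)"

definition closed_finite_inter :: "'x pfs set \<Rightarrow> bool" where
  "closed_finite_inter \<B> \<longleftrightarrow> (\<forall>F. finite F \<longrightarrow> F \<noteq> {} \<longrightarrow> F \<subseteq> \<B> \<longrightarrow> \<Inter>\<^sub>p F \<in> \<B>)"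

definition pf_base_rel :: "'x pfs set \<Rightarrow> 'x pfs set \<Rightarrow> bool" where
  "pf_base_rel \<B> T \<longleftrightarrow>
     pf_I \<in> T \<and> pf_O \<in> T \<and>
     (\<forall>V. V \<in> T - {pf_O, pf_I} \<and> \<not> V \<parallel> pf_O \<longleftrightarrow>
        (\<exists>F. F \<noteq> {} \<and> F \<subseteq> \<B> \<and> V = \<Union>\<^sub>p F)) \<and>
     (\<forall>V. V \<in> T - {pf_O, pf_I} \<and> V \<parallel> pf_O \<longleftrightarrow>
        (\<exists>F. F \<noteq> {} \<and> F \<subseteq> \<B> \<and> V = pf_O \<union>\<^sub>p \<Union>\<^sub>p F))"

definition pf_base :: "'x pfs set \<Rightarrow> 'x pfs set \<Rightarrow> bool" where
  "pf_base \<B> T \<longleftrightarrow> pf_base_rel \<B> T \<and> pf_topology T"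

end

theory Submission
  imports Defs
begin

text \<open>
  Order picture fuzzy sets by \<open>pos\<close> increasing and \<open>neu\<close>, \<open>neg\<close> decreasing. Then unions are least
  upper bounds and \<open>I\<close> is the top element, so identities between unions reduce to comparing upper
  bounds. By (ii) and (iii), the members of the family other than \<open>I\<close> and \<open>O\<close> are exactly the
  unions of base members and the sets \<open>O \<union> W\<close> with \<open>W\<close> such a union. Closure under unions then
  amounts to merging the base families. For intersections, \<open>\<inter>\<close> (although not the infimum of this
  order) distributes over unions and satisfies \<open>(O \<union> A) \<inter> B = O \<union> (A \<inter> B)\<close>, \<open>I \<inter> A = O \<union> A\<close> and
  \<open>O \<inter> A = O\<close>.
\<close>

definition pf_le :: "'x pfs \<Rightarrow> 'x pfs \<Rightarrow> bool"  (infix \<open>\<le>\<^sub>p\<close> 50) where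
  "A \<le>\<^sub>p B \<longleftrightarrow> (\<forall>x. pos A x \<le> pos B x \<and> neu B x \<le> neu A x \<and> neg B x \<le> neg A x)"

text \<open>Taking \<open>U\<close> to be \<open>A\<close> and \<open>B\<close> gives both
  inequalities by reflexivity; antisymmetry holds because the three functions determine the
  set.\<close>

lemma pf_eq_by_upper_bounds:
  assumes "\<And>U. A \<le>\<^sub>p U \<longleftrightarrow> B \<le>\<^sub>p U"
  shows "A = B"
proof -
  have "A \<le>\<^sub>p B" "B \<le>\<^sub>p A"
    using assms [of A] assms [of B] by (simp_all add: pf_le_def)
  then show ?thesis
    by (intro pfs_eqI) (auto simp: pf_le_def intro: antisym)
qed

lemma pf_le_refl: "A \<le>\<^sub>p A"
  by (simp add: pf_le_def)

lemma pf_le_I: "A \<le>\<^sub>p pf_I"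
  by (simp add: pf_le_def pfs_bounds)

lemma pf_I_le_iff: "pf_I \<le>\<^sub>p U \<longleftrightarrow> U = pf_I"
proof
  assume le: "pf_I \<le>\<^sub>p U"
  show "U = pf_I"
  proof (rule pfs_eqI)
    fix x
    have "1 \<le> pos U x" "neu U x \<le> 0" "neg U x \<le> 0"
      using le by (auto simp: pf_le_def)
    then show "pos U x = pos pf_I x" "neu U x = neu pf_I x" "neg U x = neg pf_I x"
      using pfs_bounds [of U x] by auto
  qed
qed (simp add: pf_le_I)

lemma pf_union_le_iff: "A \<union>\<^sub>p B \<le>\<^sub>p U \<longleftrightarrow> A \<le>\<^sub>p U \<and> B \<le>\<^sub>p U"
  by (auto simp: pf_le_def)

text \<open>The reals are only conditionally complete, so \<open>cSUP_le_iff\<close> and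
  \<open>le_cINF_iff\<close> need these bounds.\<close>

lemma bdd_pfs:
  "bdd_above ((\<lambda>A. pos A x) ` F)" "bdd_below ((\<lambda>A. neu A x) ` F)" "bdd_below ((\<lambda>A. neg A x) ` F)"
  by (auto intro!: bdd_aboveI2 [of _ _ 1] bdd_belowI2 [of _ 0] simp: pfs_bounds)

lemma pf_Union_le_iff:
  assumes "F \<noteq> {}"
  shows "\<Union>\<^sub>p F \<le>\<^sub>p U \<longleftrightarrow> (\<forall>A\<in>F. A \<le>\<^sub>p U)"
  using assms by (auto simp: pf_le_def pfs_Union_sel cSUP_le_iff le_cINF_iff bdd_pfs)

lemma pf_inter_commute: "A \<inter>\<^sub>p B = B \<inter>\<^sub>p A"
  by (rule pfs_eqI) (simp_all add: min.commute max.commute)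

lemma pf_Union_inter_distrib:
  assumes "F \<noteq> {}"
  shows "\<Union>\<^sub>p F \<inter>\<^sub>p B = \<Union>\<^sub>p ((\<lambda>A. A \<inter>\<^sub>p B) ` F)"
proof (rule pf_eq_by_upper_bounds)
  fix U
  have "\<Union>\<^sub>p F \<inter>\<^sub>p B \<le>\<^sub>p U \<longleftrightarrow> (\<forall>A\<in>F. A \<inter>\<^sub>p B \<le>\<^sub>p U)"
    \<comment> \<open>Each component becomes a condition for all members of \<open>F\<close>, joined
      by a disjunction (\<open>pos\<close>, \<open>neg\<close>) or a conjunction
      (\<open>neu\<close>) to one on \<open>B\<close> alone. Pulling the latter out of the
      quantifier in the \<open>neu\<close> case needs \<open>F\<close> non-empty.\<close>
    unfolding pf_le_def pfs_inter_sel pfs_Union_sel [OF assms] min_le_iff_disj le_max_iff_disj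
      min.bounded_iff cSUP_le_iff [OF assms bdd_pfs(1)] le_cINF_iff [OF assms bdd_pfs(2)]
      le_cINF_iff [OF assms bdd_pfs(3)]
    using assms by blast
  then show "\<Union>\<^sub>p F \<inter>\<^sub>p B \<le>\<^sub>p U \<longleftrightarrow> \<Union>\<^sub>p ((\<lambda>A. A \<inter>\<^sub>p B) ` F) \<le>\<^sub>p U"
    using assms by (simp add: pf_Union_le_iff)
qed

lemma pf_Union_inter_Union:
  assumes "F \<noteq> {}" "G \<noteq> {}"
  shows "\<Union>\<^sub>p F \<inter>\<^sub>p \<Union>\<^sub>p G = \<Union>\<^sub>p {A \<inter>\<^sub>p B | A B. A \<in> F \<and> B \<in> G}"
proof (rule pf_eq_by_upper_bounds)
  fix U
  have ne: "{A \<inter>\<^sub>p B | A B. A \<in> F \<and> B \<in> G} \<noteq> {}"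
    using assms by blast
  have "A \<inter>\<^sub>p \<Union>\<^sub>p G = \<Union>\<^sub>p ((\<lambda>B. A \<inter>\<^sub>p B) ` G)" for A
    using pf_Union_inter_distrib [OF assms(2), of A] by (simp only: pf_inter_commute [of A])
  then show "\<Union>\<^sub>p F \<inter>\<^sub>p \<Union>\<^sub>p G \<le>\<^sub>p U \<longleftrightarrow> \<Union>\<^sub>p {A \<inter>\<^sub>p B | A B. A \<in> F \<and> B \<in> G} \<le>\<^sub>p U"
    using assms by (auto simp: pf_Union_inter_distrib pf_Union_le_iff pf_Union_le_iff [OF ne])
qed

text \<open>Union with \<open>pf_O\<close> keeps \<open>pos\<close> and \<open>neg\<close> and sets
  \<open>neu\<close> to 0; as intersection takes the minimum of \<open>neu\<close>, it makes no
  difference whether this is done before or after.\<close>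

lemma O_union_inter: "(pf_O \<union>\<^sub>p A) \<inter>\<^sub>p B = pf_O \<union>\<^sub>p (A \<inter>\<^sub>p B)"
  by (rule pfs_eqI) (simp_all add: pfs_bounds)

lemma O_union_O_union: "pf_O \<union>\<^sub>p (pf_O \<union>\<^sub>p A) = pf_O \<union>\<^sub>p A"
  by (rule pf_eq_by_upper_bounds) (simp add: pf_union_le_iff)

lemma I_inter: "pf_I \<inter>\<^sub>p A = pf_O \<union>\<^sub>p A"
  by (rule pfs_eqI) (simp_all add: pfs_bounds)

lemma O_inter: "pf_O \<inter>\<^sub>p A = pf_O"
  by (rule pfs_eqI) (simp_all add: pfs_bounds)

definition pf_unions :: "'x pfs set \<Rightarrow> 'x pfs set" where
  "pf_unions \<B> = {\<Union>\<^sub>p F | F. F \<noteq> {} \<and> F \<subseteq> \<B>}"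

text \<open>Conditions (ii) and (iii) treat the two cases of \<open>V \<parallel> pf_O\<close>;
  merging them removes the case split.\<close>

lemma pf_base_rel_iff:
  assumes "pf_base_rel \<B> T"
  shows "V \<in> T \<longleftrightarrow> V = pf_I \<or> V = pf_O \<or> V \<in> pf_unions \<B> \<or> (\<exists>W\<in>pf_unions \<B>. V = pf_O \<union>\<^sub>p W)"
proof -
  have unions: "W \<in> pf_unions \<B> \<longleftrightarrow> (\<exists>F. F \<noteq> {} \<and> F \<subseteq> \<B> \<and> W = \<Union>\<^sub>p F)" for W
    unfolding pf_unions_def by (rule mem_Collect_eq [THEN trans]) metis
  have O_unions: "(\<exists>W\<in>pf_unions \<B>. V = pf_O \<union>\<^sub>p W) \<longleftrightarrow>
      (\<exists>F. F \<noteq> {} \<and> F \<subseteq> \<B> \<and> V = pf_O \<union>\<^sub>p \<Union>\<^sub>p F)"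
    using unions by metis
  have "V \<in> T - {pf_O, pf_I} \<and> \<not> V \<parallel> pf_O \<longleftrightarrow> V \<in> pf_unions \<B>"
    unfolding unions using assms by (simp add: pf_base_rel_def)
  moreover have "V \<in> T - {pf_O, pf_I} \<and> V \<parallel> pf_O \<longleftrightarrow> (\<exists>W\<in>pf_unions \<B>. V = pf_O \<union>\<^sub>p W)"
    unfolding O_unions using assms by (simp add: pf_base_rel_def)
  moreover have "pf_I \<in> T" "pf_O \<in> T"
    using assms by (simp_all add: pf_base_rel_def)
  ultimately show ?thesis by blast
qed

lemma pf_unions_inter:
  assumes "closed_finite_inter \<B>" "V \<in> pf_unions \<B>" "W \<in> pf_unions \<B>"
  shows "V \<inter>\<^sub>p W \<in> pf_unions \<B>"
proof -
  have closed: "A \<inter>\<^sub>p B \<in> \<B>" if "A \<in> \<B>" "B \<in> \<B>" for A B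
    using assms(1) that unfolding closed_finite_inter_def
    by (auto simp flip: pf_Inter_pair)
  obtain F G where F: "F \<noteq> {}" "F \<subseteq> \<B>" "V = \<Union>\<^sub>p F" and G: "G \<noteq> {}" "G \<subseteq> \<B>" "W = \<Union>\<^sub>p G"
    using assms by (auto simp: pf_unions_def)
  have "V \<inter>\<^sub>p W = \<Union>\<^sub>p {A \<inter>\<^sub>p B | A B. A \<in> F \<and> B \<in> G}"
    using F G by (simp add: pf_Union_inter_Union)
  moreover have "{A \<inter>\<^sub>p B | A B. A \<in> F \<and> B \<in> G} \<noteq> {}" "{A \<inter>\<^sub>p B | A B. A \<in> F \<and> B \<in> G} \<subseteq> \<B>"
    using F G closed by blast+
  ultimately show ?thesis unfolding pf_unions_def by blast
qed

text \<open>Choose a base family for each member of \<open>\<W>\<close>; all these families together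
  have the same upper bounds as \<open>\<W>\<close>.\<close>

lemma pf_unions_Union:
  assumes "\<W> \<noteq> {}" "\<W> \<subseteq> pf_unions \<B>"
  shows "\<Union>\<^sub>p \<W> \<in> pf_unions \<B>"
proof -
  have "\<forall>V\<in>\<W>. \<exists>F. F \<noteq> {} \<and> F \<subseteq> \<B> \<and> V = \<Union>\<^sub>p F"
    using assms(2) unfolding pf_unions_def by blast
  from bchoice [OF this] obtain F
    where F: "\<forall>V\<in>\<W>. F V \<noteq> {} \<and> F V \<subseteq> \<B> \<and> V = \<Union>\<^sub>p (F V)" ..
  have ne: "(\<Union>V\<in>\<W>. F V) \<noteq> {}" using F assms(1) by blast
  have "\<Union>\<^sub>p \<W> = \<Union>\<^sub>p (\<Union>V\<in>\<W>. F V)"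
  proof (rule pf_eq_by_upper_bounds)
    fix U
    have "V \<le>\<^sub>p U \<longleftrightarrow> (\<forall>A\<in>F V. A \<le>\<^sub>p U)" if "V \<in> \<W>" for V
    proof -
      have "F V \<noteq> {}" "V = \<Union>\<^sub>p (F V)" using F that by simp_all
      then show ?thesis using pf_Union_le_iff [of "F V" U] by simp
    qed
    then show "\<Union>\<^sub>p \<W> \<le>\<^sub>p U \<longleftrightarrow> \<Union>\<^sub>p (\<Union>V\<in>\<W>. F V) \<le>\<^sub>p U"
      unfolding pf_Union_le_iff [OF ne] pf_Union_le_iff [OF assms(1)] by blast
  qed
  moreover have "(\<Union>V\<in>\<W>. F V) \<subseteq> \<B>" using F by blast
  ultimately show ?thesis using ne unfolding pf_unions_def by blast
qed

lemma pf_base_rel_inter: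
  assumes rel: "pf_base_rel \<B> T" and "closed_finite_inter \<B>" and "A \<in> T" "B \<in> T"
  shows "A \<inter>\<^sub>p B \<in> T"
proof -
  note T = pf_base_rel_iff [OF rel]
  have O_union: "pf_O \<union>\<^sub>p V \<in> T" if "V \<in> T" for V
  proof -
    have "pf_O \<union>\<^sub>p pf_I = pf_I" "pf_O \<union>\<^sub>p pf_O = (pf_O :: 'a pfs)"
      by (rule pfs_eqI; simp)+
    then show ?thesis using that by (auto simp: T O_union_O_union)
  qed
  note inter = O_union_inter I_inter O_inter
  \<comment> \<open>First one factor is a union of base members and \<open>B\<close> is split into
    its four forms; the final step splits \<open>A\<close> in the same way.\<close>
  have 1: "V \<inter>\<^sub>p B \<in> T" if "V \<in> pf_unions \<B>" for V
  proof -
    have "W \<inter>\<^sub>p V \<in> T" if "W \<in> pf_unions \<B>" for W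
      using pf_unions_inter [OF assms(2) that \<open>V \<in> pf_unions \<B>\<close>] by (simp add: T)
    moreover have "V \<in> T" "pf_O \<in> T" using that by (auto simp: T)
    \<comment> \<open>The factors are swapped because the laws in \<open>inter\<close> rewrite the
      left one.\<close>
    ultimately have "B \<inter>\<^sub>p V \<in> T"
      using \<open>B \<in> T\<close> [unfolded T] by (auto simp: inter intro!: O_union)
    then show ?thesis by (simp add: pf_inter_commute)
  qed
  have "pf_O \<in> T" by (simp add: T)
  then show ?thesis
    using \<open>A \<in> T\<close> [unfolded T] O_union [OF \<open>B \<in> T\<close>] O_union [OF 1] 1 by (auto simp: inter)
qed

lemma pf_base_rel_Union:
  assumes rel: "pf_base_rel \<B> T" and "F \<noteq> {}" "F \<subseteq> T"
  shows "\<Union>\<^sub>p F \<in> T"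
proof -
  note T = pf_base_rel_iff [OF rel]
  \<comment> \<open>These are the unions of base members occurring in \<open>F\<close>, alone or
    joined with \<open>pf_O\<close>.\<close>
  define \<W> where "\<W> = {W \<in> pf_unions \<B>. W \<in> F \<or> pf_O \<union>\<^sub>p W \<in> F}"
  consider "pf_I \<in> F" | "F = {pf_O}" | "F \<subseteq> pf_unions \<B>"
    | V where "pf_I \<notin> F" "F \<noteq> {pf_O}" "V \<in> F" "V \<notin> pf_unions \<B>"
    by blast
  then show ?thesis
  proof cases
    case 1
    then have "pf_I \<le>\<^sub>p \<Union>\<^sub>p F"
      using pf_Union_le_iff [OF assms(2), of "\<Union>\<^sub>p F"] by (simp add: pf_le_refl)
    then have "\<Union>\<^sub>p F = pf_I" by (simp add: pf_I_le_iff)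
    then show ?thesis by (simp add: T)
  next
    case 2
    then have "\<Union>\<^sub>p F = pf_O"
      by (intro pf_eq_by_upper_bounds) (simp add: pf_Union_le_iff)
    then show ?thesis by (simp add: T)
  next
    case 3
    then show ?thesis using pf_unions_Union assms(2) by (auto simp: T)
  next
    case 4
    have form: "A = pf_O \<or> A \<in> \<W> \<or> (\<exists>W\<in>\<W>. A = pf_O \<union>\<^sub>p W)" if "A \<in> F" for A
      using that assms(3) 4 unfolding \<W>_def subset_iff T by blast
    \<comment> \<open>Some member of \<open>F\<close> differs from \<open>pf_O\<close>, and by
      \<open>form\<close> it yields an element of \<open>\<W>\<close>.\<close>
    have ne: "\<W> \<noteq> {}" using form 4(2) assms(2) by blast
    have "\<Union>\<^sub>p F = pf_O \<union>\<^sub>p \<Union>\<^sub>p \<W>"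
    proof (rule pf_eq_by_upper_bounds)
      fix U
      \<comment> \<open>So \<open>V\<close> lies above \<open>pf_O\<close>: every upper bound of
        \<open>F\<close> bounds \<open>pf_O\<close> too, and adding \<open>pf_O\<close> to the union
        of \<open>\<W>\<close> is harmless.\<close>
      have "V = pf_O \<or> (\<exists>W. V = pf_O \<union>\<^sub>p W)"
        using form [OF 4(3)] 4(4) by (auto simp: \<W>_def)
      then have "V \<le>\<^sub>p U \<Longrightarrow> pf_O \<le>\<^sub>p U" by (auto simp: pf_union_le_iff)
      moreover have "W \<le>\<^sub>p U" if "\<forall>A\<in>F. A \<le>\<^sub>p U" "W \<in> \<W>" for W
        using that by (auto simp: \<W>_def pf_union_le_iff)
      moreover have "A \<le>\<^sub>p U" if "pf_O \<le>\<^sub>p U" "\<forall>W\<in>\<W>. W \<le>\<^sub>p U" "A \<in> F" for A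
        using form [OF that(3)] that(1,2) by (auto simp: pf_union_le_iff)
      ultimately show "\<Union>\<^sub>p F \<le>\<^sub>p U \<longleftrightarrow> pf_O \<union>\<^sub>p \<Union>\<^sub>p \<W> \<le>\<^sub>p U"
        unfolding pf_union_le_iff pf_Union_le_iff [OF ne] pf_Union_le_iff [OF assms(2)]
        using 4(3) by blast
    qed
    moreover have "\<Union>\<^sub>p \<W> \<in> pf_unions \<B>"
      using ne by (rule pf_unions_Union) (auto simp: \<W>_def)
    ultimately show ?thesis unfolding T by blast
  qed
qed

theorem theorem12:
  fixes \<B> \<II> :: "'x pfs set"
  assumes "pf_I \<notin> \<B>" and "pf_O \<notin> \<B>"
    and "pf_base_rel \<B> \<II>"
    and "closed_finite_inter \<B>"
  shows "pf_base \<B> \<II>"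
proof -
  have "pf_I \<in> \<II>" "pf_O \<in> \<II>"
    using assms(3) by (auto simp: pf_base_rel_def)
  then have "pf_topology \<II>"
    unfolding pf_topology_def
    using pf_base_rel_inter [OF assms(3,4)] pf_base_rel_Union [OF assms(3)] by blast
  then show ?thesis using assms(3) by (simp add: pf_base_def)
qed

end
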